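(* For a given terminating program $p_0$ of $\mathcal{W}$, the axiomatic semantics $[\![ p_0 ]\!]$ is $\mathcal{W}$-sound, i.e. $M \vDash [\![ p_0 ]\!]$ for every execution interpretation $M$ of $p_0$.
   Context: $[\![ p_0 ]\!] := \bigwedge_{s \text{ statement of } p_0} \forall \mathit{enclIts}.\,(\mathit{Reach}(\mathit{start}_s)\rightarrow [\![ s ]\!])$, where $\mathit{enclIts}$ are the iteration variables of loops enclosing $s$ and $[\![ s ]\!]$ is: for skip, all variables equal at $\mathit{end}_s$ and $\mathit{start}_s$; for $v=e$, $v(\mathit{end}_s)\simeq$ value of $e$ at $\mathit{start}_s$, other variables unchanged; for $a[e_1]=e_2$, $a$ at $\mathit{end}_s$ equals $a$ at $\mathit{start}_s$ except at position $e_1$ where it equals $e_2$ (evaluated at $\mathit{start}_s$), other variables unchanged; for if-then-else, if the condition holds (resp. fails) at $\mathit{start}_s$ all variables at the start of the then- (resp. else-)branch equal those at $\mathit{start}_s$; for $\mathtt{while(Cond)\{c\}}$, the condition holds at $tp_s(it)$ for all $it<\mathit{lastIt}_s$ and fails at $tp_s(\mathit{lastIt}_s)$, all variables at $\mathit{start}_c$ equal those at $tp_s(it)$ for $it<\mathit{lastIt}_s$, and all variables at $\mathit{end}_s$ equal those at $tp_s(\mathit{lastIt}_s)$. An execution interpretation is a first-order interpretation induced by a run of the small-step operational semantics of $\mathcal{W}$, interpreting $\mathit{Reach}$ as the set of reached timepoints and program variables according to the transition rules at reached timepoints. *)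

theory Defs
  imports Main
begin

section \<open>The programming language W\<close>

text \<open>Numeric variables and array variables live in separate name spaces. Arrays are total
  functions from integer positions to integers.\<close>

type_synonym vname = string

datatype aop = Plus | Minus | Times

datatype cop = Eq | Less | Leq

datatype aexp =
    Num int
  | Var vname
  | Sel vname aexp
  | Op aop aexp aexp

datatype bexp =
    BConst bool
  | BNot bexp
  | BAnd bexp bexp
  | BOr bexp bexp
  | BCmp cop aexp aexp

text \<open>A context is a nonempty sequence of statements.\<close>

datatype stmt =
    Skip
  | Assign vname aexp
  | AssignArr vname aexp aexp
  | If bexp ctx ctx
  | While bexp ctx
and ctx =
    Last stmt
  | Seq stmt ctx

type_synonym program = ctx

fun aexp_nvars :: "aexp \<Rightarrow> vname list" where
  "aexp_nvars (Num n) = []"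
| "aexp_nvars (Var v) = [v]"
| "aexp_nvars (Sel a e) = aexp_nvars e"
| "aexp_nvars (Op f e1 e2) = aexp_nvars e1 @ aexp_nvars e2"

fun aexp_avars :: "aexp \<Rightarrow> vname list" where
  "aexp_avars (Num n) = []"
| "aexp_avars (Var v) = []"
| "aexp_avars (Sel a e) = a # aexp_avars e"
| "aexp_avars (Op f e1 e2) = aexp_avars e1 @ aexp_avars e2"

fun bexp_nvars :: "bexp \<Rightarrow> vname list" where
  "bexp_nvars (BConst b) = []"
| "bexp_nvars (BNot b) = bexp_nvars b"
| "bexp_nvars (BAnd b1 b2) = bexp_nvars b1 @ bexp_nvars b2"
| "bexp_nvars (BOr b1 b2) = bexp_nvars b1 @ bexp_nvars b2"
| "bexp_nvars (BCmp c e1 e2) = aexp_nvars e1 @ aexp_nvars e2"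

fun bexp_avars :: "bexp \<Rightarrow> vname list" where
  "bexp_avars (BConst b) = []"
| "bexp_avars (BNot b) = bexp_avars b"
| "bexp_avars (BAnd b1 b2) = bexp_avars b1 @ bexp_avars b2"
| "bexp_avars (BOr b1 b2) = bexp_avars b1 @ bexp_avars b2"
| "bexp_avars (BCmp c e1 e2) = aexp_avars e1 @ aexp_avars e2"

fun stmt_nvars :: "stmt \<Rightarrow> vname list" and ctx_nvars :: "ctx \<Rightarrow> vname list" where
  "stmt_nvars Skip = []"
| "stmt_nvars (Assign v e) = v # aexp_nvars e"
| "stmt_nvars (AssignArr a e1 e2) = aexp_nvars e1 @ aexp_nvars e2"
| "stmt_nvars (If b c1 c2) = bexp_nvars b @ ctx_nvars c1 @ ctx_nvars c2"
| "stmt_nvars (While b c) = bexp_nvars b @ ctx_nvars c"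
| "ctx_nvars (Last s) = stmt_nvars s"
| "ctx_nvars (Seq s c) = stmt_nvars s @ ctx_nvars c"

fun stmt_avars :: "stmt \<Rightarrow> vname list" and ctx_avars :: "ctx \<Rightarrow> vname list" where
  "stmt_avars Skip = []"
| "stmt_avars (Assign v e) = aexp_avars e"
| "stmt_avars (AssignArr a e1 e2) = a # aexp_avars e1 @ aexp_avars e2"
| "stmt_avars (If b c1 c2) = bexp_avars b @ ctx_avars c1 @ ctx_avars c2"
| "stmt_avars (While b c) = bexp_avars b @ ctx_avars c"
| "ctx_avars (Last s) = stmt_avars s"
| "ctx_avars (Seq s c) = stmt_avars s @ ctx_avars c"


section \<open>Locations and timepoints\<close>

text \<open>The location of a statement is its position (a path) in the program, so distinct
  occurrences of a statement have distinct locations. The iteration variable of a loop is named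
  by the location of the loop. A timepoint is a location symbol applied to iterations:
  one for each enclosing loop (outermost first), and, for a loop, its own iteration as last
  argument. The argument type is \<open>nat\<close> for ground timepoints, and a type of iteration terms
  for symbolic ones.\<close>

type_synonym loc = "nat list"

datatype iter = It loc | Zero | Next iter

datatype 'i timepoint = At loc "'i list" | EndTp

fun iter_val :: "(loc \<Rightarrow> nat) \<Rightarrow> iter \<Rightarrow> nat" where
  "iter_val \<rho> (It w) = \<rho> w"
| "iter_val \<rho> Zero = 0"
| "iter_val \<rho> (Next i) = Suc (iter_val \<rho> i)"

definition ground :: "(loc \<Rightarrow> nat) \<Rightarrow> iter timepoint \<Rightarrow> nat timepoint" where
  "ground \<rho> = map_timepoint (iter_val \<rho>)"

text \<open>In the following functions, \<open>l\<close> is the location of a statement (or the path of a context)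
  and \<open>ws\<close> the list of locations of its enclosing loops.\<close>

fun tp :: "loc \<Rightarrow> loc list \<Rightarrow> stmt \<Rightarrow> iter timepoint" where
  "tp l ws (While b c) = At l (map It ws @ [It l])"
| "tp l ws s = At l (map It ws)"

fun start :: "loc \<Rightarrow> loc list \<Rightarrow> stmt \<Rightarrow> iter timepoint" where
  "start l ws (While b c) = At l (map It ws @ [Zero])"
| "start l ws s = At l (map It ws)"

fun start_ctx :: "loc \<Rightarrow> loc list \<Rightarrow> ctx \<Rightarrow> iter timepoint" where
  "start_ctx l ws (Last s) = start (l @ [0]) ws s"
| "start_ctx l ws (Seq s c) = start (l @ [0]) ws s"

text \<open>All statement occurrences, each as a tuple of its location, its enclosing loops, its end
  timepoint and the statement itself. The end timepoint \<open>e\<close> of a statement is the start of the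
  next statement in its context; for the last statement of a context it is the end of the
  enclosing conditional, the next iteration of the enclosing loop, or the end of the program.\<close>

type_synonym occ = "loc \<times> loc list \<times> iter timepoint \<times> stmt"

fun occs_stmt :: "loc \<Rightarrow> loc list \<Rightarrow> iter timepoint \<Rightarrow> stmt \<Rightarrow> occ list"
  and occs_ctx :: "loc \<Rightarrow> loc list \<Rightarrow> iter timepoint \<Rightarrow> ctx \<Rightarrow> occ list" where
  "occs_stmt l ws e Skip = [(l, ws, e, Skip)]"
| "occs_stmt l ws e (Assign v a) = [(l, ws, e, Assign v a)]"
| "occs_stmt l ws e (AssignArr v a1 a2) = [(l, ws, e, AssignArr v a1 a2)]"
| "occs_stmt l ws e (If b c1 c2) =
     (l, ws, e, If b c1 c2) # occs_ctx (l @ [0]) ws e c1 @ occs_ctx (l @ [1]) ws e c2"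
| "occs_stmt l ws e (While b c) =
     (l, ws, e, While b c) #
     occs_ctx (l @ [0]) (ws @ [l]) (At l (map It ws @ [Next (It l)])) c"
| "occs_ctx l ws e (Last s) = occs_stmt (l @ [0]) ws e s"
| "occs_ctx l ws e (Seq s c) =
     occs_stmt (l @ [0]) ws (start_ctx (l @ [1]) ws c) s @ occs_ctx (l @ [1]) ws e c"

definition occs :: "program \<Rightarrow> occ list" where
  "occs p = occs_ctx [] [] EndTp p"

definition start_prog :: "program \<Rightarrow> nat timepoint" where
  "start_prog p = ground (\<lambda>_. 0) (start_ctx [] [] p)"

definition timepoints :: "program \<Rightarrow> nat timepoint set" where
  "timepoints p =
     insert EndTp {ground \<sigma> (tp l ws s) | \<sigma> l ws e s. (l, ws, e, s) \<in> set (occs p)}"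


section \<open>Small-step operational semantics\<close>

record state =
  num :: "vname \<Rightarrow> int"
  arr :: "vname \<Rightarrow> int \<Rightarrow> int"

fun aop_val :: "aop \<Rightarrow> int \<Rightarrow> int \<Rightarrow> int" where
  "aop_val Plus x y = x + y"
| "aop_val Minus x y = x - y"
| "aop_val Times x y = x * y"

fun cop_val :: "cop \<Rightarrow> int \<Rightarrow> int \<Rightarrow> bool" where
  "cop_val Eq x y \<longleftrightarrow> x = y"
| "cop_val Less x y \<longleftrightarrow> x < y"
| "cop_val Leq x y \<longleftrightarrow> x \<le> y"

fun aval :: "aexp \<Rightarrow> state \<Rightarrow> int" where
  "aval (Num n) st = n"
| "aval (Var v) st = num st v"
| "aval (Sel a e) st = arr st a (aval e st)"
| "aval (Op f e1 e2) st = aop_val f (aval e1 st) (aval e2 st)"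

fun bval :: "bexp \<Rightarrow> state \<Rightarrow> bool" where
  "bval (BConst b) st \<longleftrightarrow> b"
| "bval (BNot b) st \<longleftrightarrow> \<not> bval b st"
| "bval (BAnd b1 b2) st \<longleftrightarrow> bval b1 st \<and> bval b2 st"
| "bval (BOr b1 b2) st \<longleftrightarrow> bval b1 st \<or> bval b2 st"
| "bval (BCmp c e1 e2) st \<longleftrightarrow> cop_val c (aval e1 st) (aval e2 st)"

definition upd_num :: "vname \<Rightarrow> int \<Rightarrow> state \<Rightarrow> state" where
  "upd_num v x st = st\<lparr>num := (num st)(v := x)\<rparr>"

definition upd_arr :: "vname \<Rightarrow> int \<Rightarrow> int \<Rightarrow> state \<Rightarrow> state" where
  "upd_arr a i x st = st\<lparr>arr := (arr st)(a := (arr st a)(i := x))\<rparr>"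

text \<open>A configuration is a ground timepoint with the values of the variables at that timepoint.
  \<open>\<sigma>\<close> assigns numbers to the iteration variables; in the rules for loops it also determines the
  current iteration \<open>\<sigma> l\<close> of the loop itself.\<close>

type_synonym config = "nat timepoint \<times> state"

inductive step :: "program \<Rightarrow> config \<Rightarrow> config \<Rightarrow> bool" for p where
  Skip: "(l, ws, e, Skip) \<in> set (occs p) \<Longrightarrow>
    step p (ground \<sigma> (start l ws Skip), st) (ground \<sigma> e, st)"
| Assign: "(l, ws, e, Assign v a) \<in> set (occs p) \<Longrightarrow>
    step p (ground \<sigma> (start l ws (Assign v a)), st) (ground \<sigma> e, upd_num v (aval a st) st)"
| AssignArr: "(l, ws, e, AssignArr v a1 a2) \<in> set (occs p) \<Longrightarrow>
    step p (ground \<sigma> (start l ws (AssignArr v a1 a2)), st)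
           (ground \<sigma> e, upd_arr v (aval a1 st) (aval a2 st) st)"
| IfTrue: "(l, ws, e, If b c1 c2) \<in> set (occs p) \<Longrightarrow> bval b st \<Longrightarrow>
    step p (ground \<sigma> (start l ws (If b c1 c2)), st) (ground \<sigma> (start_ctx (l @ [0]) ws c1), st)"
| IfFalse: "(l, ws, e, If b c1 c2) \<in> set (occs p) \<Longrightarrow> \<not> bval b st \<Longrightarrow>
    step p (ground \<sigma> (start l ws (If b c1 c2)), st) (ground \<sigma> (start_ctx (l @ [1]) ws c2), st)"
| WhileTrue: "(l, ws, e, While b c) \<in> set (occs p) \<Longrightarrow> bval b st \<Longrightarrow>
    step p (ground \<sigma> (tp l ws (While b c)), st)
           (ground \<sigma> (start_ctx (l @ [0]) (ws @ [l]) c), st)"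
| WhileFalse: "(l, ws, e, While b c) \<in> set (occs p) \<Longrightarrow> \<not> bval b st \<Longrightarrow>
    step p (ground \<sigma> (tp l ws (While b c)), st) (ground \<sigma> e, st)"

text \<open>The rules are deterministic, so the configurations reachable from the initial one form the
  run of the program from \<open>st0\<close>.\<close>

definition reached :: "program \<Rightarrow> state \<Rightarrow> nat timepoint \<Rightarrow> state \<Rightarrow> bool" where
  "reached p st0 t st \<longleftrightarrow> (step p)\<^sup>*\<^sup>* (start_prog p, st0) (t, st)"

definition terminating :: "program \<Rightarrow> bool" where
  "terminating p \<longleftrightarrow>
     (\<forall>st0. \<not> (\<exists>f :: nat \<Rightarrow> config. f 0 = (start_prog p, st0) \<and> (\<forall>i. step p (f i) (f (Suc i)))))"


section \<open>Trace logic\<close>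

text \<open>Many-sorted first-order formulas over iterations, timepoints and integers.
  \<open>LastIt l is\<close> is the symbol for the last iteration of the loop at \<open>l\<close>, applied to iterations
  of the loops enclosing it.\<close>

datatype iterm = Iter iter | LastIt loc "iter list"

type_synonym tterm = "iterm timepoint"

datatype vterm =
    Lit int
  | PosVar string
  | NumAt vname tterm
  | ArrAt vname tterm vterm
  | OpT aop vterm vterm

datatype formula =
    Top
  | Reach tterm
  | Cmp cop vterm vterm
  | ItLess iterm iterm
  | Neg formula
  | Conj formula formula
  | Disj formula formula
  | Imp formula formula
  | AllIt loc formula
  | AllPos string formula

definition Conjs :: "formula list \<Rightarrow> formula" where
  "Conjs \<phi>s = foldr Conj \<phi>s Top"

record 'tp interp =
  tpI :: "nat timepoint \<Rightarrow> 'tp"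
  lastItI :: "loc \<Rightarrow> nat list \<Rightarrow> nat"
  reachI :: "'tp \<Rightarrow> bool"
  numI :: "vname \<Rightarrow> 'tp \<Rightarrow> int"
  arrI :: "vname \<Rightarrow> 'tp \<Rightarrow> int \<Rightarrow> int"

fun iterm_val :: "'tp interp \<Rightarrow> (loc \<Rightarrow> nat) \<Rightarrow> iterm \<Rightarrow> nat" where
  "iterm_val M \<rho> (Iter i) = iter_val \<rho> i"
| "iterm_val M \<rho> (LastIt l is) = lastItI M l (map (iter_val \<rho>) is)"

definition tterm_val :: "'tp interp \<Rightarrow> (loc \<Rightarrow> nat) \<Rightarrow> tterm \<Rightarrow> 'tp" where
  "tterm_val M \<rho> t = tpI M (map_timepoint (iterm_val M \<rho>) t)"

fun vterm_val :: "'tp interp \<Rightarrow> (loc \<Rightarrow> nat) \<Rightarrow> (string \<Rightarrow> int) \<Rightarrow> vterm \<Rightarrow> int" where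
  "vterm_val M \<rho> \<eta> (Lit n) = n"
| "vterm_val M \<rho> \<eta> (PosVar x) = \<eta> x"
| "vterm_val M \<rho> \<eta> (NumAt v t) = numI M v (tterm_val M \<rho> t)"
| "vterm_val M \<rho> \<eta> (ArrAt a t u) = arrI M a (tterm_val M \<rho> t) (vterm_val M \<rho> \<eta> u)"
| "vterm_val M \<rho> \<eta> (OpT f u1 u2) = aop_val f (vterm_val M \<rho> \<eta> u1) (vterm_val M \<rho> \<eta> u2)"

fun sat :: "'tp interp \<Rightarrow> (loc \<Rightarrow> nat) \<Rightarrow> (string \<Rightarrow> int) \<Rightarrow> formula \<Rightarrow> bool" where
  "sat M \<rho> \<eta> Top \<longleftrightarrow> True"
| "sat M \<rho> \<eta> (Reach t) \<longleftrightarrow> reachI M (tterm_val M \<rho> t)"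
| "sat M \<rho> \<eta> (Cmp c u1 u2) \<longleftrightarrow> cop_val c (vterm_val M \<rho> \<eta> u1) (vterm_val M \<rho> \<eta> u2)"
| "sat M \<rho> \<eta> (ItLess i j) \<longleftrightarrow> iterm_val M \<rho> i < iterm_val M \<rho> j"
| "sat M \<rho> \<eta> (Neg \<phi>) \<longleftrightarrow> \<not> sat M \<rho> \<eta> \<phi>"
| "sat M \<rho> \<eta> (Conj \<phi> \<psi>) \<longleftrightarrow> sat M \<rho> \<eta> \<phi> \<and> sat M \<rho> \<eta> \<psi>"
| "sat M \<rho> \<eta> (Disj \<phi> \<psi>) \<longleftrightarrow> sat M \<rho> \<eta> \<phi> \<or> sat M \<rho> \<eta> \<psi>"
| "sat M \<rho> \<eta> (Imp \<phi> \<psi>) \<longleftrightarrow> (sat M \<rho> \<eta> \<phi> \<longrightarrow> sat M \<rho> \<eta> \<psi>)"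
| "sat M \<rho> \<eta> (AllIt w \<phi>) \<longleftrightarrow> (\<forall>n. sat M (\<rho>(w := n)) \<eta> \<phi>)"
| "sat M \<rho> \<eta> (AllPos x \<phi>) \<longleftrightarrow> (\<forall>k. sat M \<rho> (\<eta>(x := k)) \<phi>)"

definition models :: "'tp interp \<Rightarrow> formula \<Rightarrow> bool" where
  "models M \<phi> \<longleftrightarrow> (\<forall>\<rho> \<eta>. sat M \<rho> \<eta> \<phi>)"


section \<open>Axiomatic semantics\<close>

abbreviation term_of_tp :: "iter timepoint \<Rightarrow> tterm" where
  "term_of_tp \<equiv> map_timepoint Iter"

fun aexp_at :: "aexp \<Rightarrow> tterm \<Rightarrow> vterm" where
  "aexp_at (Num n) t = Lit n"
| "aexp_at (Var v) t = NumAt v t"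
| "aexp_at (Sel a e) t = ArrAt a t (aexp_at e t)"
| "aexp_at (Op f e1 e2) t = OpT f (aexp_at e1 t) (aexp_at e2 t)"

fun bexp_at :: "bexp \<Rightarrow> tterm \<Rightarrow> formula" where
  "bexp_at (BConst b) t = (if b then Top else Neg Top)"
| "bexp_at (BNot b) t = Neg (bexp_at b t)"
| "bexp_at (BAnd b1 b2) t = Conj (bexp_at b1 t) (bexp_at b2 t)"
| "bexp_at (BOr b1 b2) t = Disj (bexp_at b1 t) (bexp_at b2 t)"
| "bexp_at (BCmp c e1 e2) t = Cmp c (aexp_at e1 t) (aexp_at e2 t)"

abbreviation (input) pos :: string where "pos \<equiv> ''pos''"

definition eq_num :: "vname \<Rightarrow> tterm \<Rightarrow> tterm \<Rightarrow> formula" where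
  "eq_num v t1 t2 = Cmp Eq (NumAt v t1) (NumAt v t2)"

definition eq_arr :: "vname \<Rightarrow> tterm \<Rightarrow> tterm \<Rightarrow> formula" where
  "eq_arr a t1 t2 = AllPos pos (Cmp Eq (ArrAt a t1 (PosVar pos)) (ArrAt a t2 (PosVar pos)))"

text \<open>Equality at two timepoints of the numeric variables \<open>ns\<close> and the array variables \<open>as\<close>.\<close>

definition eq_vars :: "vname list \<Rightarrow> vname list \<Rightarrow> tterm \<Rightarrow> tterm \<Rightarrow> formula" where
  "eq_vars ns as t1 t2 =
     Conj (Conjs (map (\<lambda>v. eq_num v t1 t2) ns)) (Conjs (map (\<lambda>a. eq_arr a t1 t2) as))"

definition eq_all :: "program \<Rightarrow> tterm \<Rightarrow> tterm \<Rightarrow> formula" where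
  "eq_all p = eq_vars (ctx_nvars p) (ctx_avars p)"

definition update_num :: "program \<Rightarrow> vname \<Rightarrow> aexp \<Rightarrow> tterm \<Rightarrow> tterm \<Rightarrow> formula" where
  "update_num p v e t_end t_start =
     Conj (Cmp Eq (NumAt v t_end) (aexp_at e t_start))
          (eq_vars (removeAll v (ctx_nvars p)) (ctx_avars p) t_end t_start)"

definition update_arr :: "program \<Rightarrow> vname \<Rightarrow> aexp \<Rightarrow> aexp \<Rightarrow> tterm \<Rightarrow> tterm \<Rightarrow> formula" where
  "update_arr p a e1 e2 t_end t_start =
     Conj (AllPos pos (Imp (Neg (Cmp Eq (PosVar pos) (aexp_at e1 t_start)))
            (Cmp Eq (ArrAt a t_end (PosVar pos)) (ArrAt a t_start (PosVar pos)))))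
     (Conj (Cmp Eq (ArrAt a t_end (aexp_at e1 t_start)) (aexp_at e2 t_start))
           (eq_vars (ctx_nvars p) (removeAll a (ctx_avars p)) t_end t_start))"

fun sem_occ :: "program \<Rightarrow> occ \<Rightarrow> formula" where
  "sem_occ p (l, ws, e, Skip) =
     eq_all p (term_of_tp e) (term_of_tp (start l ws Skip))"
| "sem_occ p (l, ws, e, Assign v a) =
     update_num p v a (term_of_tp e) (term_of_tp (start l ws (Assign v a)))"
| "sem_occ p (l, ws, e, AssignArr v a1 a2) =
     update_arr p v a1 a2 (term_of_tp e) (term_of_tp (start l ws (AssignArr v a1 a2)))"
| "sem_occ p (l, ws, e, If b c1 c2) =
     (let t = term_of_tp (start l ws (If b c1 c2)) in
      Conj (Imp (bexp_at b t) (eq_all p (term_of_tp (start_ctx (l @ [0]) ws c1)) t))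
           (Imp (Neg (bexp_at b t)) (eq_all p (term_of_tp (start_ctx (l @ [1]) ws c2)) t)))"
| "sem_occ p (l, ws, e, While b c) =
     (let t_it = term_of_tp (tp l ws (While b c));
          lastIt = LastIt l (map It ws);
          t_last = At l (map (Iter \<circ> It) ws @ [lastIt]) in
      Conj (AllIt l (Imp (ItLess (Iter (It l)) lastIt) (bexp_at b t_it)))
     (Conj (Neg (bexp_at b t_last))
     (Conj (AllIt l (Imp (ItLess (Iter (It l)) lastIt)
              (eq_all p (term_of_tp (start_ctx (l @ [0]) (ws @ [l]) c)) t_it)))
           (eq_all p (term_of_tp e) t_last))))"

definition axiomatic_semantics :: "program \<Rightarrow> formula" where
  "axiomatic_semantics p =
     Conjs (map (\<lambda>(l, ws, e, s).
       foldr AllIt ws (Imp (Reach (term_of_tp (start l ws s))) (sem_occ p (l, ws, e, s))))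
     (occs p))"


section \<open>Execution interpretations\<close>

text \<open>The interpretation is constrained only by the run from some initial state \<open>st0\<close>:
  variables are unconstrained at unreached timepoints, and so is the last iteration of a
  loop whose exit is not reached.\<close>

definition execution_interp :: "program \<Rightarrow> 'tp interp \<Rightarrow> bool" where
  "execution_interp p M \<longleftrightarrow> (\<exists>st0.
     (\<forall>t \<in> timepoints p. reachI M (tpI M t) \<longleftrightarrow> (\<exists>st. reached p st0 t st)) \<and>
     (\<forall>t st. reached p st0 t st \<longrightarrow>
        (\<forall>v \<in> set (ctx_nvars p). numI M v (tpI M t) = num st v) \<and>
        (\<forall>a \<in> set (ctx_avars p). arrI M a (tpI M t) = arr st a)) \<and>
     (\<forall>l ws e b c \<sigma> st. (l, ws, e, While b c) \<in> set (occs p) \<longrightarrow>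
        reached p st0 (ground \<sigma> (tp l ws (While b c))) st \<longrightarrow> \<not> bval b st \<longrightarrow>
        lastItI M l (map \<sigma> ws) = \<sigma> l))"

end

theory Submission
  imports Defs
begin

text \<open>A step of the run from a reached timepoint leads to a reached timepoint, and an execution
  interpretation agrees with the run on the program variables at reached timepoints, so every
  conjunct that relates the two ends of a transition holds. The conjunct of a loop also needs
  that a reached loop is eventually left: termination makes the step relation well-founded on
  the reached configurations, and by structural induction every reached statement reaches its
  end. The exit reached in this way fixes the last iteration of the loop.\<close>

section \<open>Occurrences of statements\<close>

text \<open>Turns a single occurrence of a loop in the program into the inclusion that a structural
  induction over its body requires.\<close>

lemma occs_stmt_subset:
  shows "(l, ws, e, s) \<in> set (occs_stmt l' ws' e' s') \<Longrightarrow>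
      set (occs_stmt l ws e s) \<subseteq> set (occs_stmt l' ws' e' s')"
    and "(l, ws, e, s) \<in> set (occs_ctx l' ws' e' c') \<Longrightarrow>
      set (occs_stmt l ws e s) \<subseteq> set (occs_ctx l' ws' e' c')"
  by (induction l' ws' e' s' and l' ws' e' c' rule: occs_stmt_occs_ctx.induct) auto

text \<open>An execution interpretation is tied to the run on program variables only, so expressions
  of an occurrence can be evaluated only once their variables are known to be among these.\<close>

lemma occs_vars_subset:
  shows "(l, ws, e, s) \<in> set (occs_stmt l' ws' e' s') \<Longrightarrow>
      set (stmt_nvars s) \<subseteq> set (stmt_nvars s') \<and> set (stmt_avars s) \<subseteq> set (stmt_avars s')"
    and "(l, ws, e, s) \<in> set (occs_ctx l' ws' e' c') \<Longrightarrow>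
      set (stmt_nvars s) \<subseteq> set (ctx_nvars c') \<and> set (stmt_avars s) \<subseteq> set (ctx_avars c')"
  by (induction l' ws' e' s' and l' ws' e' c' rule: occs_stmt_occs_ctx.induct) auto

section \<open>Scoping of iteration variables\<close>

text \<open>Enclosing loops sit at proper prefixes of \<open>l\<close>; comparing lengths is enough
  to separate \<open>l\<close> from them and survives extension of the path. The second clause says
  semantically that \<open>e\<close> mentions iterations of enclosing loops only.\<close>

definition well_scoped :: "loc \<Rightarrow> loc list \<Rightarrow> iter timepoint \<Rightarrow> bool" where
  "well_scoped l ws e \<longleftrightarrow> (\<forall>w \<in> set ws. length w < length l) \<and>
     (\<forall>\<sigma> \<sigma>'. (\<forall>w \<in> set ws. \<sigma> w = \<sigma>' w) \<longrightarrow> ground \<sigma> e = ground \<sigma>' e)"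

lemma well_scoped_fresh: "well_scoped l ws e \<Longrightarrow> l \<notin> set ws"
  by (auto simp: well_scoped_def)

text \<open>A loop is left under an assignment that records its exit iteration, while its end
  timepoint is meant under the original one; both agree on the enclosing loops.\<close>

lemma well_scoped_ground_upd: "well_scoped l ws e \<Longrightarrow> ground (\<sigma>(l := n)) e = ground \<sigma> e"
  using well_scoped_fresh[of l ws e] unfolding well_scoped_def
  by (metis fun_upd_other)

lemma ground_start_cong:
  "(\<forall>w \<in> set ws. \<sigma> w = \<sigma>' w) \<Longrightarrow> ground \<sigma> (start l ws s) = ground \<sigma>' (start l ws s)"
  by (cases s) (auto simp: ground_def)

lemma ground_start_ctx_cong:
  "(\<forall>w \<in> set ws. \<sigma> w = \<sigma>' w) \<Longrightarrow> ground \<sigma> (start_ctx l ws c) = ground \<sigma>' (start_ctx l ws c)"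
  by (cases c) (auto intro: ground_start_cong)

lemma well_scoped_snoc: "well_scoped l ws e \<Longrightarrow> well_scoped (l @ [i]) ws e"
  by (auto simp: well_scoped_def less_Suc_eq)

lemma well_scoped_start_ctx: "well_scoped l ws e \<Longrightarrow> well_scoped (l @ [i]) ws (start_ctx l' ws c)"
  using ground_start_ctx_cong by (fastforce simp: well_scoped_def)

lemma well_scoped_body:
  "well_scoped l ws e \<Longrightarrow> well_scoped (l @ [i]) (ws @ [l]) (At l (map It ws @ [Next (It l)]))"
  by (auto simp: well_scoped_def less_Suc_eq ground_def)

text \<open>Every recursive call that lists occurrences extends the path and either inherits the end
  timepoint, takes the start of the remaining context, or takes the next iteration of the loop just
  entered. The three preceding lemmas cover these cases.\<close>

lemma well_scoped_occs:
  shows "well_scoped l' ws' e' \<Longrightarrow> (l, ws, e, s) \<in> set (occs_stmt l' ws' e' s') \<Longrightarrow> well_scoped l ws e"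
    and "well_scoped l' ws' e' \<Longrightarrow> (l, ws, e, s) \<in> set (occs_ctx l' ws' e' c') \<Longrightarrow> well_scoped l ws e"
  by (induction l' ws' e' s' and l' ws' e' c' rule: occs_stmt_occs_ctx.induct)
    (auto intro: well_scoped_snoc well_scoped_start_ctx well_scoped_body)

lemma occs_well_scoped: "(l, ws, e, s) \<in> set (occs p) \<Longrightarrow> well_scoped l ws e"
  unfolding occs_def by (rule well_scoped_occs(2)) (auto simp: well_scoped_def ground_def)

text \<open>The argument \<open>Zero\<close> becomes the value 0 of the loop's own iteration
  variable; freshness of \<open>l\<close> keeps the arguments for the enclosing loops
  unchanged.\<close>

lemma ground_start_While:
  assumes "l \<notin> set ws"
  shows "ground \<sigma> (start l ws (While b c)) = ground (\<sigma>(l := 0)) (tp l ws (While b c))"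
  using assms by (auto simp: ground_def)

text \<open>The meaning of \<open>Reach\<close> is fixed on \<open>timepoints p\<close>, which is
  built from \<open>tp\<close>, whereas the axioms guard each conjunct by
  \<open>start\<close>.\<close>

lemma ground_start_in_timepoints:
  assumes "(l, ws, e, s) \<in> set (occs p)"
  shows "ground \<sigma> (start l ws s) \<in> timepoints p"
proof -
  have "\<exists>\<sigma>'. ground \<sigma> (start l ws s) = ground \<sigma>' (tp l ws s)"
    using ground_start_While[OF well_scoped_fresh[OF occs_well_scoped[OF assms]]]
    by (cases s) (auto simp del: start.simps(1) tp.simps(1))
  then show ?thesis
    using assms unfolding timepoints_def by blast
qed

section \<open>Termination\<close>

text \<open>Localizes nontermination to an arbitrary configuration, so that its absence can be
  passed on along the run.\<close>

definition diverges :: "program \<Rightarrow> config \<Rightarrow> bool" where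
  "diverges p x \<longleftrightarrow> (\<exists>f. f 0 = x \<and> (\<forall>i. step p (f i) (f (Suc i))))"

lemma step_diverges:
  assumes "step p x y" "diverges p y"
  shows "diverges p x"
proof -
  obtain f where "f 0 = y" "\<forall>i. step p (f i) (f (Suc i))"
    using assms(2) unfolding diverges_def by blast
  \<comment> \<open>\<open>case_nat x f\<close> is the infinite run \<open>f\<close> with
    \<open>x\<close> put in front.\<close>
  then have "case_nat x f 0 = x \<and> (\<forall>i. step p (case_nat x f i) (case_nat x f (Suc i)))"
    using assms(1) by (auto split: nat.split)
  then show ?thesis
    unfolding diverges_def by blast
qed

lemma steps_diverges: "(step p)\<^sup>*\<^sup>* x y \<Longrightarrow> diverges p y \<Longrightarrow> diverges p x"
  by (induction rule: converse_rtranclp_induct) (auto intro: step_diverges)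

lemma terminating_reached:
  "terminating p \<Longrightarrow> reached p st0 t st \<Longrightarrow> \<not> diverges p (t, st)"
  unfolding reached_def terminating_def
  by (metis diverges_def steps_diverges)

text \<open>Well-founded induction along the run. The hypothesis covers all configurations reached
  in one or more steps, because successive iterations of a loop are many steps apart.\<close>

lemma not_diverges_induct [consumes 1, case_names not_diverges]:
  assumes "\<not> diverges p x"
    and IH: "\<And>x. \<not> diverges p x \<Longrightarrow> (\<And>y. (step p)\<^sup>+\<^sup>+ x y \<Longrightarrow> P y) \<Longrightarrow> P x"
  shows "P x"
proof -
  let ?R = "{(y, x). step p x y \<and> \<not> diverges p x}"
  \<comment> \<open>An infinite chain in \<open>?R\<close> would witness divergence of its own first
    element, which \<open>?R\<close> excludes.\<close>
  have wf: "wf (?R\<^sup>+)"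
    by (intro wf_trancl) (auto simp: wf_iff_no_infinite_down_chain diverges_def)
  \<comment> \<open>Successors of a configuration that does not diverge do not diverge either, so
    the whole path stays within \<open>?R\<close>.\<close>
  have sub: "(y, x) \<in> ?R\<^sup>+" if "(step p)\<^sup>+\<^sup>+ x y" "\<not> diverges p x" for x y
    using that
  proof (induction rule: tranclp_induct)
    case (base y)
    then show ?case by auto
  next
    case (step y z)
    then have "\<not> diverges p y"
      by (meson steps_diverges tranclp_into_rtranclp)
    then have "(z, y) \<in> ?R"
      using step by simp
    then show ?case
      using step by (meson trancl_into_trancl2)
  qed
  have "\<not> diverges p x \<longrightarrow> P x"
  proof (induction x rule: wf_induct_rule[OF wf])
    case (1 x)
    show ?case
    proof
      assume nd: "\<not> diverges p x"
      show "P x"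
      proof (rule IH[OF nd])
        fix y
        assume y: "(step p)\<^sup>+\<^sup>+ x y"
        then have "\<not> diverges p y"
          using nd by (meson steps_diverges tranclp_into_rtranclp)
        then show "P y"
          using 1 sub[OF y nd] by blast
      qed
    qed
  qed
  then show ?thesis
    using assms(1) by blast
qed

section \<open>Loops are left and statements reach their ends\<close>

text \<open>Induction along the run: either the condition fails now, or the body leads to the next
  iteration, which lies strictly later. Hence the start is an arbitrary iteration
  \<open>\<sigma> l\<close> and not 0. The premise \<open>body\<close> is what a structural
  induction supplies for the loop body.\<close>

lemma loop_exits:
  assumes occ: "(l, ws, e, While b c) \<in> set (occs p)"
    and body: "\<And>\<sigma> st. \<not> diverges p (ground \<sigma> (start_ctx (l @ [0]) (ws @ [l]) c), st) \<Longrightarrow>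
      \<exists>st'. (step p)\<^sup>*\<^sup>* (ground \<sigma> (start_ctx (l @ [0]) (ws @ [l]) c), st)
                    (ground \<sigma> (At l (map It ws @ [Next (It l)])), st')"
    and "\<not> diverges p (ground \<sigma> (tp l ws (While b c)), st)"
  shows "\<exists>N st'. (step p)\<^sup>*\<^sup>* (ground \<sigma> (tp l ws (While b c)), st)
                       (ground (\<sigma>(l := N)) (tp l ws (While b c)), st') \<and> \<not> bval b st' \<and>
     (\<forall>k. \<sigma> l \<le> k \<longrightarrow> k < N \<longrightarrow>
       (\<exists>st''. (step p)\<^sup>*\<^sup>* (ground \<sigma> (tp l ws (While b c)), st)
                       (ground (\<sigma>(l := k)) (tp l ws (While b c)), st'') \<and> bval b st''))"
    (is "?P \<sigma> st")
proof -
  let ?t = "tp l ws (While b c)"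
  have fresh: "l \<notin> set ws"
    using occ by (rule well_scoped_fresh[OF occs_well_scoped])
  \<comment> \<open>The assignment is quantified inside the induction, since it changes from one
    iteration to the next.\<close>
  have "\<forall>\<sigma> st. x = (ground \<sigma> ?t, st) \<longrightarrow> ?P \<sigma> st" if "\<not> diverges p x" for x
    using that
  proof (induction rule: not_diverges_induct)
    case (not_diverges x)
    show ?case
    proof (intro allI impI)
      fix \<sigma> st
      assume x: "x = (ground \<sigma> ?t, st)"
      show "?P \<sigma> st"
      proof (cases "bval b st")
        case False
        then show ?thesis
          \<comment> \<open>The exit is the current iteration, so the range of \<open>k\<close> is
            empty.\<close>
          by (intro exI[of _ "\<sigma> l"] exI[of _ st]) auto
      next
        case True
        let ?y = "(ground \<sigma> (start_ctx (l @ [0]) (ws @ [l]) c), st)"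
        let ?\<sigma> = "\<sigma>(l := Suc (\<sigma> l))"
        have xy: "step p x ?y"
          unfolding x using occ True by (rule step.WhileTrue)
        have "\<not> diverges p ?y"
          using not_diverges(1) xy step_diverges by blast
        then obtain st' where
          st': "(step p)\<^sup>*\<^sup>* ?y (ground \<sigma> (At l (map It ws @ [Next (It l)])), st')"
          using body by blast
        \<comment> \<open>The end of the body is the loop's own timepoint with the iteration
          variable increased by one.\<close>
        have "ground \<sigma> (At l (map It ws @ [Next (It l)])) = ground ?\<sigma> ?t"
          using fresh by (auto simp: ground_def)
        with xy st' have next_it: "(step p)\<^sup>+\<^sup>+ x (ground ?\<sigma> ?t, st')"
          by (metis rtranclp_into_tranclp2)
        from not_diverges(2)[OF this] obtain N st'' where
          N: "(step p)\<^sup>*\<^sup>* (ground ?\<sigma> ?t, st') (ground (?\<sigma>(l := N)) ?t, st'')" "\<not> bval b st''"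
            "\<And>k. Suc (\<sigma> l) \<le> k \<Longrightarrow> k < N \<Longrightarrow>
               \<exists>st''. (step p)\<^sup>*\<^sup>* (ground ?\<sigma> ?t, st') (ground (?\<sigma>(l := k)) ?t, st'') \<and> bval b st''"
          by (metis fun_upd_same)
        have trans: "(step p)\<^sup>*\<^sup>* x z" if "(step p)\<^sup>*\<^sup>* (ground ?\<sigma> ?t, st') z" for z
          using next_it that by (meson rtranclp_trans tranclp_into_rtranclp)
        \<comment> \<open>The current iteration is \<open>x\<close> itself; the later ones come from
          the induction hypothesis.\<close>
        have "\<exists>st''. (step p)\<^sup>*\<^sup>* x (ground (\<sigma>(l := k)) ?t, st'') \<and> bval b st''"
          if "\<sigma> l \<le> k" "k < N" for k
        proof (cases "k = \<sigma> l")
          case True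
          then show ?thesis
            using \<open>bval b st\<close> unfolding x by (metis fun_upd_triv rtranclp.rtrancl_refl)
        next
          case False
          then have "Suc (\<sigma> l) \<le> k"
            using that by simp
          from N(3)[OF this that(2)] trans show ?thesis
            by (metis fun_upd_upd)
        qed
        moreover have "(step p)\<^sup>*\<^sup>* x (ground (\<sigma>(l := N)) ?t, st'')"
          using trans[OF N(1)] by simp
        ultimately show ?thesis
          using N(2) unfolding x by blast
      qed
    qed
  qed
  then show ?thesis
    using assms(3) by blast
qed

text \<open>Mutual structural induction; the inclusion of occurrences makes the transition rules of
  \<open>p\<close> applicable to every substatement. Absence of divergence passes to each
  intermediate configuration, and for a loop the hypothesis on its body feeds
  \<open>loop_exits\<close>.\<close>

lemma reaches_end:
  shows "set (occs_stmt l ws e s) \<subseteq> set (occs p) \<Longrightarrow>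
      \<not> diverges p (ground \<sigma> (start l ws s), st) \<Longrightarrow>
      \<exists>st'. (step p)\<^sup>*\<^sup>* (ground \<sigma> (start l ws s), st) (ground \<sigma> e, st')"
    and "set (occs_ctx l ws e c) \<subseteq> set (occs p) \<Longrightarrow>
      \<not> diverges p (ground \<sigma> (start_ctx l ws c), st) \<Longrightarrow>
      \<exists>st'. (step p)\<^sup>*\<^sup>* (ground \<sigma> (start_ctx l ws c), st) (ground \<sigma> e, st')"
proof (induction l ws e s and l ws e c arbitrary: \<sigma> st and \<sigma> st rule: occs_stmt_occs_ctx.induct)
  case (1 l ws e)
  then have "(l, ws, e, Skip) \<in> set (occs p)" by simp
  from step.Skip[OF this] show ?case by blast
next
  case (2 l ws e v a)
  then have "(l, ws, e, Assign v a) \<in> set (occs p)" by simp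
  from step.Assign[OF this] show ?case by blast
next
  case (3 l ws e v a1 a2)
  then have "(l, ws, e, AssignArr v a1 a2) \<in> set (occs p)" by simp
  from step.AssignArr[OF this] show ?case by blast
next
  case (4 l ws e b c1 c2)
  then have occ: "(l, ws, e, If b c1 c2) \<in> set (occs p)" by simp
  show ?case
  proof (cases "bval b st")
    case True
    have "step p (ground \<sigma> (start l ws (If b c1 c2)), st) (ground \<sigma> (start_ctx (l @ [0]) ws c1), st)"
      using occ True by (rule step.IfTrue)
    moreover from this have "\<not> diverges p (ground \<sigma> (start_ctx (l @ [0]) ws c1), st)"
      using 4(4) step_diverges by blast
    moreover have "set (occs_ctx (l @ [0]) ws e c1) \<subseteq> set (occs p)"
      using 4(3) by simp
    ultimately show ?thesis
      using 4(1) by (meson converse_rtranclp_into_rtranclp)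
  next
    case False
    have "step p (ground \<sigma> (start l ws (If b c1 c2)), st) (ground \<sigma> (start_ctx (l @ [1]) ws c2), st)"
      using occ False by (rule step.IfFalse)
    moreover from this have "\<not> diverges p (ground \<sigma> (start_ctx (l @ [1]) ws c2), st)"
      using 4(4) step_diverges by blast
    moreover have "set (occs_ctx (l @ [1]) ws e c2) \<subseteq> set (occs p)"
      using 4(3) by simp
    ultimately show ?thesis
      using 4(2) by (meson converse_rtranclp_into_rtranclp)
  qed
next
  case (5 l ws e b c)
  let ?t = "tp l ws (While b c)"
  from 5 have occ: "(l, ws, e, While b c) \<in> set (occs p)" by simp
  note scoped = occs_well_scoped[OF occ]
  have start: "ground \<sigma> (start l ws (While b c)) = ground (\<sigma>(l := 0)) ?t"
    using well_scoped_fresh[OF scoped] by (rule ground_start_While)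
  have sub: "set (occs_ctx (l @ [0]) (ws @ [l]) (At l (map It ws @ [Next (It l)])) c) \<subseteq> set (occs p)"
    using 5(2) by simp
  obtain N st' where
    N: "(step p)\<^sup>*\<^sup>* (ground (\<sigma>(l := 0)) ?t, st) (ground (\<sigma>(l := N)) ?t, st')" "\<not> bval b st'"
    using loop_exits[OF occ 5(1)[OF sub] 5(3)[unfolded start]] by (metis fun_upd_upd)
  \<comment> \<open>The rule yields the end timepoint under \<open>\<sigma>(l := N)\<close>;
    \<open>e\<close> does not depend on the iteration of the loop itself.\<close>
  from step.WhileFalse[OF occ N(2)]
  have "step p (ground (\<sigma>(l := N)) ?t, st') (ground \<sigma> e, st')"
    by (metis well_scoped_ground_upd[OF scoped])
  then show ?case
    using N(1) unfolding start by (meson rtranclp.rtrancl_into_rtrancl)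
next
  case (6 l ws e s)
  then show ?case by simp
next
  case (7 l ws e s c)
  let ?mid = "start_ctx (l @ [1]) ws c"
  from 7 obtain st1 where
    st1: "(step p)\<^sup>*\<^sup>* (ground \<sigma> (start (l @ [0]) ws s), st) (ground \<sigma> ?mid, st1)"
    by (metis le_sup_iff occs_ctx.simps(2) set_append start_ctx.simps(2))
  then have "\<not> diverges p (ground \<sigma> ?mid, st1)"
    using 7(4) steps_diverges by (metis start_ctx.simps(2))
  then obtain st' where "(step p)\<^sup>*\<^sup>* (ground \<sigma> ?mid, st1) (ground \<sigma> e, st')"
    using 7(2,3) by fastforce
  with st1 show ?case
    by (metis rtranclp_trans start_ctx.simps(2))
qed

text \<open>\<open>loop_exits\<close> entered at iteration 0, with the premise on the body
  discharged by \<open>reaches_end\<close>. All iterations before \<open>N\<close> are thereby known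
  to be reached with a true condition.\<close>

lemma occ_loop_exits:
  assumes "(l, ws, e, While b c) \<in> set (occs p)"
    and "\<not> diverges p (ground \<sigma> (start l ws (While b c)), st)"
  obtains N st' where
    "(step p)\<^sup>*\<^sup>* (ground \<sigma> (start l ws (While b c)), st) (ground (\<sigma>(l := N)) (tp l ws (While b c)), st')"
    and "\<not> bval b st'"
    and "\<And>k. k < N \<Longrightarrow> \<exists>st''. (step p)\<^sup>*\<^sup>* (ground \<sigma> (start l ws (While b c)), st)
           (ground (\<sigma>(l := k)) (tp l ws (While b c)), st'') \<and> bval b st''"
proof -
  have start: "ground \<sigma> (start l ws (While b c)) = ground (\<sigma>(l := 0)) (tp l ws (While b c))"
    by (rule ground_start_While[OF well_scoped_fresh[OF occs_well_scoped[OF assms(1)]]])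
  have "set (occs_stmt l ws e (While b c)) \<subseteq> set (occs p)"
    using assms(1) unfolding occs_def by (rule occs_stmt_subset(2))
  then have sub: "set (occs_ctx (l @ [0]) (ws @ [l]) (At l (map It ws @ [Next (It l)])) c) \<subseteq> set (occs p)"
    by simp
  show thesis
    using loop_exits[OF assms(1) reaches_end(2)[OF sub] assms(2)[unfolded start]] that
    unfolding start by (metis fun_upd_upd fun_upd_same zero_le)
qed

section \<open>Evaluation at reached timepoints\<close>

text \<open>Stated for an element of the timepoint domain, so that it also applies to the value of a
  timepoint term built with \<open>LastIt\<close>.\<close>

definition agrees :: "program \<Rightarrow> 'tp interp \<Rightarrow> 'tp \<Rightarrow> state \<Rightarrow> bool" where
  "agrees p M t st \<longleftrightarrow> (\<forall>v \<in> set (ctx_nvars p). numI M v t = num st v) \<and>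
     (\<forall>a \<in> set (ctx_avars p). arrI M a t = arr st a)"

lemma vterm_val_aexp_at:
  assumes "agrees p M (tterm_val M \<rho> t) st"
    and "set (aexp_nvars e) \<subseteq> set (ctx_nvars p)" "set (aexp_avars e) \<subseteq> set (ctx_avars p)"
  shows "vterm_val M \<rho> \<eta> (aexp_at e t) = aval e st"
  using assms(2,3) by (induction e) (use assms(1) in \<open>auto simp: agrees_def\<close>)

lemma sat_bexp_at:
  assumes "agrees p M (tterm_val M \<rho> t) st"
    and "set (bexp_nvars b) \<subseteq> set (ctx_nvars p)" "set (bexp_avars b) \<subseteq> set (ctx_avars p)"
  shows "sat M \<rho> \<eta> (bexp_at b t) \<longleftrightarrow> bval b st"
  using assms(2,3)
proof (induction b)
  case (BCmp c e1 e2)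
  then show ?case
    using vterm_val_aexp_at[OF assms(1)] by (cases c) auto
qed auto

lemma tterm_val_term_of_tp: "tterm_val M \<rho> (term_of_tp t) = tpI M (ground \<rho> t)"
  by (simp add: tterm_val_def ground_def timepoint.map_comp comp_def)

lemma sat_Conjs: "sat M \<rho> \<eta> (Conjs \<phi>s) \<longleftrightarrow> (\<forall>\<phi> \<in> set \<phi>s. sat M \<rho> \<eta> \<phi>)"
  by (induction \<phi>s) (auto simp: Conjs_def)

lemma sat_eq_vars:
  "sat M \<rho> \<eta> (eq_vars ns as t1 t2) \<longleftrightarrow>
     (\<forall>v \<in> set ns. numI M v (tterm_val M \<rho> t1) = numI M v (tterm_val M \<rho> t2)) \<and>
     (\<forall>a \<in> set as. arrI M a (tterm_val M \<rho> t1) = arrI M a (tterm_val M \<rho> t2))"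
  by (auto simp: eq_vars_def sat_Conjs eq_num_def eq_arr_def)

text \<open>Serves all transitions that keep the state: both of their ends agree with one and the
  same \<open>st\<close>.\<close>

lemma sat_eq_all:
  assumes "agrees p M (tterm_val M \<rho> t1) st" "agrees p M (tterm_val M \<rho> t2) st"
  shows "sat M \<rho> \<eta> (eq_all p t1 t2)"
  using assms by (auto simp: eq_all_def sat_eq_vars agrees_def)

lemma sat_foldr_AllIt: "(\<And>\<rho>. sat M \<rho> \<eta> \<phi>) \<Longrightarrow> sat M \<rho> \<eta> (foldr AllIt ws \<phi>)"
  by (induction ws arbitrary: \<rho>) auto

section \<open>Soundness\<close>

text \<open>The constraints of an execution interpretation are taken for one fixed
  \<open>st0\<close>, so that the start of the statement and all timepoints it leads to belong to
  the same run.\<close>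

lemma sem_occ_sound:
  fixes M :: "'tp interp"
  assumes occ: "(l, ws, e, s) \<in> set (occs p)"
    and agrees: "\<And>t st. reached p st0 t st \<Longrightarrow> agrees p M (tpI M t) st"
    and last: "\<And>l ws e b c \<sigma> st. (l, ws, e, While b c) \<in> set (occs p) \<Longrightarrow>
        reached p st0 (ground \<sigma> (tp l ws (While b c))) st \<Longrightarrow> \<not> bval b st \<Longrightarrow>
        lastItI M l (map \<sigma> ws) = \<sigma> l"
    and "terminating p"
    and reach: "reached p st0 (ground \<rho> (start l ws s)) st"
  shows "sat M \<rho> \<eta> (sem_occ p (l, ws, e, s))"
proof -
  have vars: "set (stmt_nvars s) \<subseteq> set (ctx_nvars p)" "set (stmt_avars s) \<subseteq> set (ctx_avars p)"
    using occs_vars_subset(2)[OF occ[unfolded occs_def]] by auto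
  have reached_steps: "reached p st0 t' st''"
    if "(step p)\<^sup>*\<^sup>* (t, st') (t', st'')" "reached p st0 t st'" for t st' t' st''
    using that unfolding reached_def by simp
  have reached_step: "reached p st0 t' st''"
    if "step p (t, st') (t', st'')" "reached p st0 t st'" for t st' t' st''
    using that reached_steps by blast
  have ag: "agrees p M (tterm_val M \<rho> (term_of_tp t)) st"
    if "reached p st0 (ground \<rho> t) st" for \<rho> t st
    using agrees[OF that] by (simp add: tterm_val_term_of_tp)
  note ag_start = ag[OF reach]
  show ?thesis
  proof (cases s)
    case Skip
    have "reached p st0 (ground \<rho> e) st"
      using reached_step[OF step.Skip reach[unfolded Skip]] occ Skip by blast
    with ag_start ag show ?thesis
      unfolding Skip sem_occ.simps by (metis sat_eq_all)
  next
    case (Assign v a)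
    have "reached p st0 (ground \<rho> e) (upd_num v (aval a st) st)"
      using reached_step[OF step.Assign reach[unfolded Assign]] occ Assign by blast
    note ag_end = ag[OF this]
    show ?thesis
      using ag_end ag_start vars vterm_val_aexp_at[OF ag_start, of a \<eta>] unfolding Assign
      by (auto simp: update_num_def sat_eq_vars agrees_def upd_num_def)
  next
    case (AssignArr a e1 e2)
    have "reached p st0 (ground \<rho> e) (upd_arr a (aval e1 st) (aval e2 st) st)"
      using reached_step[OF step.AssignArr reach[unfolded AssignArr]] occ AssignArr by blast
    note ag_end = ag[OF this]
    \<comment> \<open>The valuation of position variables stays schematic in the evaluation facts:
      index and value are evaluated outside the quantifier over \<open>pos\<close>, the index also
      below it.\<close>
    show ?thesis
      using ag_end ag_start vars vterm_val_aexp_at[OF ag_start, of e1]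
        vterm_val_aexp_at[OF ag_start, of e2]
      unfolding AssignArr
      by (auto simp: update_arr_def sat_eq_vars agrees_def upd_arr_def)
  next
    case (If b c1 c2)
    have b: "sat M \<rho> \<eta> (bexp_at b (term_of_tp (start l ws s))) \<longleftrightarrow> bval b st"
      using ag_start vars unfolding If by (intro sat_bexp_at) auto
    have "reached p st0 (ground \<rho> (start_ctx (l @ [0]) ws c1)) st" if "bval b st"
      using reached_step[OF step.IfTrue reach[unfolded If]] occ If that by blast
    moreover have "reached p st0 (ground \<rho> (start_ctx (l @ [1]) ws c2)) st" if "\<not> bval b st"
      using reached_step[OF step.IfFalse reach[unfolded If]] occ If that by blast
    ultimately show ?thesis
      using b sat_eq_all[OF ag ag_start] unfolding If by (auto simp: Let_def)
  next
    case (While b c)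
    let ?t = "tp l ws (While b c)"
    let ?last = "LastIt l (map It ws)"
    let ?tlast = "At l (map (Iter \<circ> It) ws @ [?last])"
    note occ' = occ[unfolded While]
    note scoped = occs_well_scoped[OF occ]
    note fresh = well_scoped_fresh[OF scoped]
    obtain N st' where
      exit_steps: "(step p)\<^sup>*\<^sup>* (ground \<rho> (start l ws s), st) (ground (\<rho>(l := N)) ?t, st')"
      and exit_cond: "\<not> bval b st'"
      and iters: "\<And>k. k < N \<Longrightarrow> \<exists>st''. (step p)\<^sup>*\<^sup>* (ground \<rho> (start l ws s), st)
           (ground (\<rho>(l := k)) ?t, st'') \<and> bval b st''"
      using occ_loop_exits[OF occ' terminating_reached[OF \<open>terminating p\<close> reach[unfolded While]]]
      unfolding While by blast
    have exit: "reached p st0 (ground (\<rho>(l := N)) ?t) st'"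
      using reached_steps[OF exit_steps reach] .
    have upd_ws: "map (\<rho>(l := n)) ws = map \<rho> ws" for n
      using fresh by auto
    \<comment> \<open>The exit fixes the last iteration; the arguments of \<open>lastItI\<close>
      belong to enclosing loops and are untouched by the update at \<open>l\<close>.\<close>
    have N: "lastItI M l (map \<rho> ws) = N"
      using last[OF occ' exit exit_cond] upd_ws[of N] by simp
    \<comment> \<open>The second form is for occurrences below the quantifier over the iterations of
      this very loop.\<close>
    have last_val: "iterm_val M \<rho> ?last = N" "iterm_val M (\<rho>(l := n)) ?last = N" for n
      using N upd_ws[of n] by (simp_all add: comp_def del: map_eq_conv fun_upd_apply)
    have "map_timepoint (iterm_val M \<rho>) ?tlast = ground (\<rho>(l := N)) ?t"
      using last_val(1) fresh by (auto simp: ground_def)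
    then have ag_last: "agrees p M (tterm_val M \<rho> ?tlast) st'"
      using agrees[OF exit] by (simp add: tterm_val_def)
    have vars_b: "set (bexp_nvars b) \<subseteq> set (ctx_nvars p)" "set (bexp_avars b) \<subseteq> set (ctx_avars p)"
      using vars While by auto
    have "step p (ground (\<rho>(l := N)) ?t, st') (ground \<rho> e, st')"
      using step.WhileFalse[OF occ' exit_cond] by (metis well_scoped_ground_upd[OF scoped])
    then have "reached p st0 (ground \<rho> e) st'"
      using exit by (rule reached_step)
    then have end_eq: "sat M \<rho> \<eta> (eq_all p (term_of_tp e) ?tlast)"
      using ag ag_last by (metis sat_eq_all)
    have exit_sat: "\<not> sat M \<rho> \<eta> (bexp_at b ?tlast)"
      using sat_bexp_at[OF ag_last vars_b] exit_cond by simp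
    \<comment> \<open>Testing the condition keeps the state, so the loop timepoint and the start of
      the body share \<open>st''\<close>.\<close>
    have iter: "sat M (\<rho>(l := k)) \<eta> (bexp_at b (term_of_tp ?t)) \<and>
       sat M (\<rho>(l := k)) \<eta>
         (eq_all p (term_of_tp (start_ctx (l @ [0]) (ws @ [l]) c)) (term_of_tp ?t))"
      if k: "k < N" for k
    proof -
      obtain st'' where "(step p)\<^sup>*\<^sup>* (ground \<rho> (start l ws s), st) (ground (\<rho>(l := k)) ?t, st'')"
        and cond: "bval b st''"
        using iters[OF k] by blast
      then have r: "reached p st0 (ground (\<rho>(l := k)) ?t) st''"
        using reached_steps reach by blast
      have "reached p st0 (ground (\<rho>(l := k)) (start_ctx (l @ [0]) (ws @ [l]) c)) st''"
        using step.WhileTrue[OF occ' cond] r by (rule reached_step)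
      from sat_eq_all[OF ag[OF this] ag[OF r]] sat_bexp_at[OF ag[OF r] vars_b] cond
      show ?thesis by blast
    qed
    show ?thesis
      unfolding While sem_occ.simps Let_def sat.simps last_val
      using iter exit_sat end_eq by simp
  qed
qed

theorem theorem4:
  fixes p\<^sub>0 :: program and M :: "'tp interp"
  assumes "terminating p\<^sub>0"
    and "execution_interp p\<^sub>0 M"
  shows "models M (axiomatic_semantics p\<^sub>0)"
proof -
  obtain st0 where
    reach: "\<And>t. t \<in> timepoints p\<^sub>0 \<Longrightarrow> reachI M (tpI M t) \<longleftrightarrow> (\<exists>st. reached p\<^sub>0 st0 t st)"
    and agrees: "\<And>t st. reached p\<^sub>0 st0 t st \<Longrightarrow> agrees p\<^sub>0 M (tpI M t) st"
    and last: "\<And>l ws e b c \<sigma> st. (l, ws, e, While b c) \<in> set (occs p\<^sub>0) \<Longrightarrow>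
        reached p\<^sub>0 st0 (ground \<sigma> (tp l ws (While b c))) st \<Longrightarrow> \<not> bval b st \<Longrightarrow>
        lastItI M l (map \<sigma> ws) = \<sigma> l"
    using assms(2) unfolding execution_interp_def
    by (elim exE conjE) (rule that, simp, simp add: agrees_def, blast)
  have "sat M \<rho> \<eta> (Imp (Reach (term_of_tp (start l ws s))) (sem_occ p\<^sub>0 (l, ws, e, s)))"
    if occ: "(l, ws, e, s) \<in> set (occs p\<^sub>0)" for l ws e s \<rho> \<eta>
  proof -
    have "sat M \<rho> \<eta> (sem_occ p\<^sub>0 (l, ws, e, s))"
      if "reachI M (tpI M (ground \<rho> (start l ws s)))"
    proof -
      obtain st where "reached p\<^sub>0 st0 (ground \<rho> (start l ws s)) st"
        using \<open>reachI M _\<close> reach[OF ground_start_in_timepoints[OF occ]] by blast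
      with occ agrees last assms(1) show ?thesis
        by (rule sem_occ_sound)
    qed
    then show ?thesis
      by (simp only: sat.simps tterm_val_term_of_tp) blast
  qed
  then show ?thesis
    unfolding models_def axiomatic_semantics_def sat_Conjs
    by (auto intro!: sat_foldr_AllIt simp del: sat.simps)
qed

end
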